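(* Let $f\in\mathbb{B}_n$ with $\deg(f)\le 2$. Then the procedure QANFto2XNF (described in the context), applied to $f$, terminates after finitely many steps and returns a 2-XNF representation of $f$.
   Context: $\mathbb{B}_n=\mathbb{F}_2[X_1,\dots,X_n]/\langle X_1^2-X_1,\dots,X_n^2-X_n\rangle$ is the ring of Boolean polynomials, with indeterminates $x_i$ the residue classes of $X_i$. $\mathbb{B}_{n,m}$ is the Boolean polynomial ring in $n+m$ indeterminates $x_1,\dots,x_n,y_1,\dots,y_m$. Every Boolean polynomial is uniquely a sum of distinct square-free terms (products of distinct indeterminates); the set of these terms is its support $\mathrm{Supp}(f)$, and the degree is the maximal degree of a term in the support. A Boolean polynomial is called linear if it lies in the $\mathbb{F}_2$-span of $1$ and the indeterminates; $\mathbb{L}_n=\langle 1,x_1,\dots,x_n\rangle_{\mathbb{F}_2}$. A non-linear term is a term of degree at least $2$. For a subset $S$ of a Boolean polynomial ring in $N$ indeterminates, $\mathcal{Z}(S)\subseteq\mathbb{F}_2^N$ is the set of common zeros of the elements of $S$. For $S\subseteq\mathbb{F}_2^n$ and $T\subseteq\mathbb{F}_2^{n+m}$ write $S\equiv_n T$ if the projection to the first $n$ coordinates restricts to a bijection $T\to S$. A set $S=\{f_1g_1,\dots,f_kg_k,\ell_1,\dots,\ell_s\}\subseteq\mathbb{B}_{n,m}$ (for some $m\ge 0$), with all $f_i,g_i,\ell_j$ linear Boolean polynomials of $\mathbb{B}_{n,m}$, is called a 2-XNF representation of an ideal $I\subseteq\mathbb{B}_n$ if $\mathcal{Z}(I)\equiv_n\mathcal{Z}(S)$.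 A 2-XNF representation of $f\in\mathbb{B}_n$ is a 2-XNF representation of $\langle f\rangle$. Procedure QANFto2XNF. Input $f\in\mathbb{B}_n$ with $\deg(f)\le 2$. Start with $i=0$, $M=\emptyset$. While $\deg(f)=2$: increase $i$ by $1$ and let $y_i$ be a new indeterminate; write $f=\ell_1\ell_2+f'$ for (any choice of) distinct $\ell_1,\ell_2\in\mathbb{L}_n$ and $f'\in\mathbb{B}_{n,i-1}$ such that $\mathrm{Supp}(f')$ contains fewer non-linear terms than $\mathrm{Supp}(f)$; set $f=y_i+f'$; adjoin $y_i(\ell_2+1)$ and $\ell_2(\ell_1+y_i)$ to $M$. Finally return $M\cup\{f\}$. *)

theory Defs
  imports Complex_Main "HOL-Library.Z2" "HOL-Library.Poly_Mapping" "HOL-Library.FuncSet"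
begin

section \<open>Polynomials over the field with two elements\<close>

type_synonym f2poly = "(nat \<Rightarrow>\<^sub>0 nat) \<Rightarrow>\<^sub>0 bit"

definition X :: "nat \<Rightarrow> f2poly" where
  "X i = Poly_Mapping.single (Poly_Mapping.single i 1) 1"

definition polys_in :: "nat \<Rightarrow> f2poly set" where
  "polys_in N = {p. \<forall>t \<in> Poly_Mapping.keys p. Poly_Mapping.keys t \<subseteq> {..<N}}"

definition monom_eval :: "(nat \<Rightarrow> bit) \<Rightarrow> (nat \<Rightarrow>\<^sub>0 nat) \<Rightarrow> bit" where
  "monom_eval a t = (\<Prod>i\<in>Poly_Mapping.keys t. a i ^ Poly_Mapping.lookup t i)"

definition poly_eval :: "(nat \<Rightarrow> bit) \<Rightarrow> f2poly \<Rightarrow> bit" where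
  "poly_eval a p = (\<Sum>t\<in>Poly_Mapping.keys p. Poly_Mapping.lookup p t * monom_eval a t)"

lemma monom_eval_superset:
  assumes "finite K" "Poly_Mapping.keys t \<subseteq> K"
  shows "monom_eval a t = (\<Prod>i\<in>K. a i ^ Poly_Mapping.lookup t i)"
  unfolding monom_eval_def using assms
  by (intro prod.mono_neutral_left) (auto simp: in_keys_iff)

lemma monom_eval_add: "monom_eval a (s + t) = monom_eval a s * monom_eval a t"
proof -
  let ?K = "Poly_Mapping.keys s \<union> Poly_Mapping.keys t"
  have "Poly_Mapping.keys (s + t) \<subseteq> ?K" by (rule Poly_Mapping.keys_add)
  then have "monom_eval a (s + t) = (\<Prod>i\<in>?K. a i ^ Poly_Mapping.lookup (s + t) i)"
    by (intro monom_eval_superset) auto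
  also have "\<dots> = (\<Prod>i\<in>?K. a i ^ Poly_Mapping.lookup s i) * (\<Prod>i\<in>?K. a i ^ Poly_Mapping.lookup t i)"
    by (simp only: lookup_add power_add prod.distrib)
  also have "\<dots> = monom_eval a s * monom_eval a t"
    by (intro arg_cong2[where f = "(*)"] monom_eval_superset[symmetric]) auto
  finally show ?thesis .
qed

lemma poly_eval_superset:
  assumes "finite K" "Poly_Mapping.keys p \<subseteq> K"
  shows "poly_eval a p = (\<Sum>t\<in>K. Poly_Mapping.lookup p t * monom_eval a t)"
  unfolding poly_eval_def using assms
  by (intro sum.mono_neutral_left) (auto simp: in_keys_iff)

lemma poly_eval_zero [simp]: "poly_eval a 0 = 0"
  by (simp add: poly_eval_def)

lemma poly_eval_add: "poly_eval a (p + q) = poly_eval a p + poly_eval a q"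
proof -
  let ?K = "Poly_Mapping.keys p \<union> Poly_Mapping.keys q"
  have "Poly_Mapping.keys (p + q) \<subseteq> ?K" by (rule Poly_Mapping.keys_add)
  then have "poly_eval a (p + q) = (\<Sum>t\<in>?K. Poly_Mapping.lookup (p + q) t * monom_eval a t)"
    by (intro poly_eval_superset) auto
  also have "\<dots> = (\<Sum>t\<in>?K. Poly_Mapping.lookup p t * monom_eval a t)
      + (\<Sum>t\<in>?K. Poly_Mapping.lookup q t * monom_eval a t)"
    by (simp only: lookup_add distrib_right sum.distrib)
  also have "\<dots> = poly_eval a p + poly_eval a q"
    by (intro arg_cong2[where f = "(+)"] poly_eval_superset[symmetric]) auto
  finally show ?thesis .
qed

lemma poly_eval_uminus: "poly_eval a (- p) = poly_eval a p"
  by (simp add: poly_eval_def)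

lemma poly_eval_diff: "poly_eval a (p - q) = poly_eval a p - poly_eval a q"
  using poly_eval_add[of a p "- q"] by (simp add: poly_eval_uminus)

lemma poly_eval_sum: "poly_eval a (sum f A) = (\<Sum>x\<in>A. poly_eval a (f x))"
  by (induction A rule: infinite_finite_induct) (auto simp: poly_eval_add)

lemma poly_eval_single: "poly_eval a (Poly_Mapping.single t c) = c * monom_eval a t"
  by (cases "c = 0") (auto simp: poly_eval_def)

lemma poly_sum_singles:
  "p = (\<Sum>t\<in>Poly_Mapping.keys p. Poly_Mapping.single t (Poly_Mapping.lookup p t))"
  for p :: "'a \<Rightarrow>\<^sub>0 'b::comm_monoid_add"
  by (rule poly_mapping_eqI)
    (simp add: lookup_sum lookup_single when_def in_keys_iff sum.delta)

lemma poly_eval_mult: "poly_eval a (p * q) = poly_eval a p * poly_eval a q"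
proof -
  have "p * q = (\<Sum>s\<in>Poly_Mapping.keys p. \<Sum>t\<in>Poly_Mapping.keys q.
      Poly_Mapping.single s (Poly_Mapping.lookup p s) * Poly_Mapping.single t (Poly_Mapping.lookup q t))"
    by (subst (1) poly_sum_singles[of p], subst (1) poly_sum_singles[of q]) (rule sum_product)
  then have "poly_eval a (p * q) = (\<Sum>s\<in>Poly_Mapping.keys p. \<Sum>t\<in>Poly_Mapping.keys q.
      (Poly_Mapping.lookup p s * monom_eval a s) * (Poly_Mapping.lookup q t * monom_eval a t))"
    by (simp only: poly_eval_sum mult_single poly_eval_single monom_eval_add mult_ac)
  then show ?thesis by (simp only: poly_eval_def sum_product)
qed

lemma poly_eval_one [simp]: "poly_eval a 1 = 1"
  using poly_eval_single[of a 0 1] by (simp add: monom_eval_def)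

lemma poly_eval_prod: "poly_eval a (prod f A) = (\<Prod>x\<in>A. poly_eval a (f x))"
  by (induction A rule: infinite_finite_induct) (auto simp: poly_eval_mult)

lemma poly_eval_X [simp]: "poly_eval a (X i) = a i"
  by (simp add: X_def poly_eval_single monom_eval_def)


lemma f2poly_double: "p + p = 0" for p :: f2poly
  by (rule poly_mapping_eqI, subst lookup_add) simp

lemma f2poly_minus_eq_plus: "p - q = p + q" for p q :: f2poly
proof -
  have "p + q = p - q + (q + q)" by simp
  then show ?thesis by (simp only: f2poly_double add_0_right)
qed

lemma polys_in_mono: "N \<le> N' \<Longrightarrow> polys_in N \<subseteq> polys_in N'"
  by (fastforce simp: polys_in_def)

lemma polys_in_ex: "\<exists>N. p \<in> polys_in N"
proof -
  have "finite (\<Union>t\<in>Poly_Mapping.keys p. Poly_Mapping.keys t)" by simp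
  then obtain N where "(\<Union>t\<in>Poly_Mapping.keys p. Poly_Mapping.keys t) \<subseteq> {..<N}"
    unfolding finite_nat_set_iff_bounded by blast
  then show ?thesis by (auto simp: polys_in_def)
qed

lemma polys_in_zero: "0 \<in> polys_in N"
  by (simp add: polys_in_def)

lemma polys_in_one: "1 \<in> polys_in N"
  by (simp add: polys_in_def)

lemma polys_in_X: "i < N \<Longrightarrow> X i \<in> polys_in N"
  by (simp add: polys_in_def X_def)

lemma polys_in_add: "p \<in> polys_in N \<Longrightarrow> q \<in> polys_in N \<Longrightarrow> p + q \<in> polys_in N"
  using Poly_Mapping.keys_add[of p q] by (fastforce simp: polys_in_def)

lemma polys_in_diff: "p \<in> polys_in N \<Longrightarrow> q \<in> polys_in N \<Longrightarrow> p - q \<in> polys_in N"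
  by (simp only: f2poly_minus_eq_plus polys_in_add)

lemma polys_in_mult:
  assumes "p \<in> polys_in N" "q \<in> polys_in N"
  shows "p * q \<in> polys_in N"
  unfolding polys_in_def
proof (intro CollectI ballI)
  fix t assume "t \<in> Poly_Mapping.keys (p * q)"
  then obtain u v where "t = u + v" "u \<in> Poly_Mapping.keys p" "v \<in> Poly_Mapping.keys q"
    using keys_mult[of p q] by blast
  then show "Poly_Mapping.keys t \<subseteq> {..<N}"
    using assms Poly_Mapping.keys_add[of u v] unfolding polys_in_def by blast
qed

lemma polys_in_power: "p \<in> polys_in N \<Longrightarrow> p ^ k \<in> polys_in N"
  by (induction k) (auto simp: polys_in_one polys_in_mult)

lemma polys_in_sum: "(\<And>x. x \<in> A \<Longrightarrow> f x \<in> polys_in N) \<Longrightarrow> sum f A \<in> polys_in N"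
  by (induction A rule: infinite_finite_induct) (auto simp: polys_in_zero polys_in_add)

lemma polys_in_prod: "(\<And>x. x \<in> A \<Longrightarrow> f x \<in> polys_in N) \<Longrightarrow> prod f A \<in> polys_in N"
  by (induction A rule: infinite_finite_induct) (auto simp: polys_in_one polys_in_mult)


section \<open>Boolean polynomials\<close>

text \<open>
  All rings \<open>B_N\<close> live in one type: the quotient of \<open>F_2[X_0, X_1, ...]\<close> by all the
  polynomials \<open>X_i^2 - X_i\<close>. The ring \<open>B_N\<close> is the subring of the classes of polynomials in
  \<open>X_0, ..., X_{N-1}\<close>, so that \<open>B_n\<close> is contained in \<open>B_{n,m} = B_{n+m}\<close>. As indices start
  at 0, the indeterminate \<open>x_j\<close> is \<open>bvar (j - 1)\<close> and \<open>y_j\<close> is \<open>bvar (n + j - 1)\<close>. The lemma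
  \<open>boolean_ideal_Int_polys_in\<close> below shows that this subring is
  \<open>F_2[X_0, ..., X_{N-1}]\<close> modulo its ideal generated by the \<open>X_i^2 - X_i\<close> for \<open>i < N\<close>.
\<close>

text \<open>Ideals of a commutative ring are its submodules.\<close>

interpretation poly_ideal: module "(*) :: f2poly \<Rightarrow> f2poly \<Rightarrow> f2poly"
  by standard (simp_all add: algebra_simps)

definition boolean_ideal :: "f2poly set" where
  "boolean_ideal = module.span (*) (range (\<lambda>i. X i ^ 2 - X i))"

lemma poly_eval_boolean_ideal:
  assumes "p \<in> boolean_ideal"
  shows "poly_eval a p = 0"
  using assms unfolding boolean_ideal_def
proof (induction rule: poly_ideal.span_induct_alt)
  case (step c x y)
  then obtain i where "x = X i ^ 2 - X i" by blast
  moreover have "a i * a i - a i = 0" by (cases "a i") auto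
  ultimately show ?case using step
    by (simp add: poly_eval_add poly_eval_mult poly_eval_diff power2_eq_square)
qed simp

definition small_ideal :: "nat \<Rightarrow> f2poly set" where
  "small_ideal N = {\<Sum>i<N. q i * (X i ^ 2 - X i) | q. \<forall>i<N. q i \<in> polys_in N}"

lemma small_ideal_subset: "small_ideal N \<subseteq> boolean_ideal"
  unfolding small_ideal_def boolean_ideal_def
proof (intro subsetI, elim CollectE exE conjE)
  fix p and q :: "nat \<Rightarrow> f2poly"
  assume "p = (\<Sum>i<N. q i * (X i ^ 2 - X i))"
  moreover have "(\<Sum>i<N. q i * (X i ^ 2 - X i))
      \<in> poly_ideal.span (range (\<lambda>i. X i ^ 2 - X i))"
    by (intro poly_ideal.span_sum poly_ideal.span_scale poly_ideal.span_base rangeI)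
  ultimately show "p \<in> poly_ideal.span (range (\<lambda>i. X i ^ 2 - X i))" by simp
qed

lemma small_ideal_subset_polys_in: "small_ideal N \<subseteq> polys_in N"
  unfolding small_ideal_def
  by (auto intro!: polys_in_sum polys_in_mult polys_in_diff polys_in_power polys_in_X)

lemma small_ideal_zero: "0 \<in> small_ideal N"
  unfolding small_ideal_def by (auto intro!: exI[of _ "\<lambda>_. 0"] simp: polys_in_zero)

lemma small_ideal_add:
  assumes "p \<in> small_ideal N" "q \<in> small_ideal N"
  shows "p + q \<in> small_ideal N"
proof -
  obtain r s where r: "p = (\<Sum>i<N. r i * (X i ^ 2 - X i))" "\<forall>i<N. r i \<in> polys_in N"
    and s: "q = (\<Sum>i<N. s i * (X i ^ 2 - X i))" "\<forall>i<N. s i \<in> polys_in N"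
    using assms unfolding small_ideal_def by blast
  have "p + q = (\<Sum>i<N. (r i + s i) * (X i ^ 2 - X i))"
    by (simp only: r(1) s(1) distrib_right sum.distrib)
  moreover have "\<forall>i<N. r i + s i \<in> polys_in N" using r s polys_in_add by blast
  ultimately show ?thesis unfolding small_ideal_def
    by (intro CollectI exI[of _ "\<lambda>i. r i + s i"]) auto
qed

lemma small_ideal_mult:
  assumes "c \<in> polys_in N" "p \<in> small_ideal N"
  shows "c * p \<in> small_ideal N"
proof -
  obtain r where r: "p = (\<Sum>i<N. r i * (X i ^ 2 - X i))" "\<forall>i<N. r i \<in> polys_in N"
    using assms unfolding small_ideal_def by blast
  have "c * p = (\<Sum>i<N. (c * r i) * (X i ^ 2 - X i))"
    by (simp only: r(1) sum_distrib_left mult.assoc)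
  moreover have "\<forall>i<N. c * r i \<in> polys_in N" using r assms polys_in_mult by blast
  ultimately show ?thesis unfolding small_ideal_def
    by (intro CollectI exI[of _ "\<lambda>i. c * r i"]) auto
qed

lemma small_ideal_gen:
  assumes "i < N"
  shows "X i ^ 2 - X i \<in> small_ideal N"
proof -
  have "(\<Sum>j<N. (if j = i then 1 else 0) * (X j ^ 2 - X j))
      = (\<Sum>j<N. if j = i then X j ^ 2 - X j else 0)"
    by (intro sum.cong) auto
  also have "\<dots> = X i ^ 2 - X i" using assms by (simp add: sum.delta)
  finally show ?thesis unfolding small_ideal_def
    by (intro CollectI exI[of _ "\<lambda>j. if j = i then 1 else 0"])
      (auto simp: polys_in_zero polys_in_one)
qed

lemma small_ideal_power:
  assumes "i < N" "k > 0"
  shows "X i ^ k - X i \<in> small_ideal N"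
  using assms(2)
proof (induction k rule: nat_induct_non_zero)
  case 1
  then show ?case by (simp add: small_ideal_zero)
next
  case (Suc k)
  have "X i * (X i ^ k - X i) + (X i ^ 2 - X i) \<in> small_ideal N"
    using assms Suc by (intro small_ideal_add small_ideal_mult small_ideal_gen polys_in_X)
  then show ?case by (simp add: algebra_simps power2_eq_square)
qed

lemma small_ideal_prod:
  assumes "finite K" "\<And>i. i \<in> K \<Longrightarrow> f i - g i \<in> small_ideal N"
    "\<And>i. i \<in> K \<Longrightarrow> f i \<in> polys_in N" "\<And>i. i \<in> K \<Longrightarrow> g i \<in> polys_in N"
  shows "prod f K - prod g K \<in> small_ideal N"
  using assms
proof (induction K rule: finite_induct)
  case empty
  then show ?case by (simp add: small_ideal_zero)
next
  case (insert i K)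
  have "prod g K * (f i - g i) + f i * (prod f K - prod g K) \<in> small_ideal N"
    using insert by (intro small_ideal_add small_ideal_mult polys_in_prod) auto
  then show ?case using insert.hyps by (simp add: algebra_simps)
qed

lemma single_eq_prod: "Poly_Mapping.single t 1 = (\<Prod>i\<in>Poly_Mapping.keys t. X i ^ Poly_Mapping.lookup t i)"
proof -
  have pow: "X i ^ k = Poly_Mapping.single (Poly_Mapping.single i k) 1" for i k
    by (induction k) (simp_all add: X_def mult_single flip: single_add)
  have "(\<Prod>i\<in>K. Poly_Mapping.single (h i) 1) = (Poly_Mapping.single (sum h K) 1 :: f2poly)"
    for h and K :: "nat set"
    by (induction K rule: infinite_finite_induct) (simp_all add: mult_single)
  from this[of "\<lambda>i. Poly_Mapping.single i (Poly_Mapping.lookup t i)" "Poly_Mapping.keys t"]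
  show ?thesis by (simp add: pow flip: poly_sum_singles)
qed

lemma small_ideal_single:
  assumes "Poly_Mapping.keys t \<subseteq> {..<N}"
  shows "Poly_Mapping.single t 1 - (\<Prod>i\<in>Poly_Mapping.keys t. X i) \<in> small_ideal N"
  unfolding single_eq_prod using assms
  by (intro small_ideal_prod small_ideal_power polys_in_power polys_in_X finite_keys)
    (auto simp: lookup_eq_zero_in_keys_contradict intro!: gr0I)

lemma squarefree_sum_add:
  fixes h :: "'a \<Rightarrow> f2poly"
  assumes "finite S" "finite T"
  shows "sum h S + sum h T = sum h ((S - T) \<union> (T - S))"
proof -
  have "sum h S = sum h (S - T) + sum h (S \<inter> T)" "sum h T = sum h (T - S) + sum h (S \<inter> T)"
    using assms by (metis sum.Int_Diff add.commute, metis sum.Int_Diff add.commute Int_commute)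
  then have "sum h S + sum h T = sum h (S - T) + sum h (T - S) + (sum h (S \<inter> T) + sum h (S \<inter> T))"
    by (simp only: ac_simps)
  also have "\<dots> = sum h ((S - T) \<union> (T - S))"
    using assms by (subst sum.union_disjoint) (auto simp only: f2poly_double add_0_right finite_Diff)
  finally show ?thesis .
qed

lemma squarefree_form:
  assumes "p \<in> polys_in N"
  shows "\<exists>T \<subseteq> Pow {..<N}. p - (\<Sum>A\<in>T. \<Prod>i\<in>A. X i) \<in> small_ideal N"
proof -
  have "\<exists>T \<subseteq> Pow {..<N}. (\<Sum>t\<in>K. Poly_Mapping.single t 1) - (\<Sum>A\<in>T. \<Prod>i\<in>A. X i) \<in> small_ideal N"
    if "finite K" "\<And>t. t \<in> K \<Longrightarrow> Poly_Mapping.keys t \<subseteq> {..<N}" for K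
    using that
  proof (induction K rule: finite_induct)
    case empty
    show ?case by (rule exI[of _ "{}"]) (simp add: small_ideal_zero)
  next
    case (insert t K)
    let ?h = "\<lambda>A. \<Prod>i\<in>A. X i"
    obtain T where T: "T \<subseteq> Pow {..<N}"
      "(\<Sum>t\<in>K. Poly_Mapping.single t 1) - sum ?h T \<in> small_ideal N"
      using insert.IH insert.prems by auto
    define S where "S = {Poly_Mapping.keys t}"
    have fin: "finite S" "finite T" using T(1) by (auto simp: S_def intro: finite_subset)
    have "Poly_Mapping.single t 1 - sum ?h S \<in> small_ideal N"
      using small_ideal_single[of t N] insert.prems by (simp add: S_def)
    from small_ideal_add[OF this T(2)]
    have "(\<Sum>t\<in>insert t K. Poly_Mapping.single t 1) - (sum ?h S + sum ?h T) \<in> small_ideal N"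
      using insert.hyps by (simp add: algebra_simps)
    moreover have "S \<subseteq> Pow {..<N}" using insert.prems by (auto simp: S_def)
    ultimately show ?case using T(1) unfolding squarefree_sum_add[OF fin]
      by (intro exI[of _ "(S - T) \<union> (T - S)"]) blast
  qed
  from this[of "Poly_Mapping.keys p"] assms
  have "\<exists>T \<subseteq> Pow {..<N}. (\<Sum>t\<in>Poly_Mapping.keys p. Poly_Mapping.single t 1) - (\<Sum>A\<in>T. \<Prod>i\<in>A. X i) \<in> small_ideal N"
    unfolding polys_in_def by simp
  moreover have "p = (\<Sum>t\<in>Poly_Mapping.keys p. Poly_Mapping.single t 1)"
  proof -
    have "(\<Sum>t\<in>Poly_Mapping.keys p. Poly_Mapping.single t (Poly_Mapping.lookup p t))
        = (\<Sum>t\<in>Poly_Mapping.keys p. Poly_Mapping.single t 1)"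
      by (intro sum.cong refl) (simp add: in_keys_iff)
    then show ?thesis using poly_sum_singles[of p] by simp
  qed
  ultimately show ?thesis by metis
qed

lemma squarefree_sum_in_ideal:
  assumes "finite T" "\<And>A. A \<in> T \<Longrightarrow> finite A" "(\<Sum>A\<in>T. \<Prod>i\<in>A. X i) \<in> boolean_ideal"
  shows "T = {}"
proof (rule ccontr)
  assume "T \<noteq> {}"
  define A where "A = arg_min_on card T"
  have A: "A \<in> T" "\<And>C. C \<in> T \<Longrightarrow> card A \<le> card C"
    using arg_min_if_finite[OF assms(1) \<open>T \<noteq> {}\<close>, of card] by (force simp: A_def)+
  define a :: "nat \<Rightarrow> bit" where "a i = of_bool (i \<in> A)" for i
  have *: "(\<Prod>i\<in>C. a i) = (if C = A then 1 else 0)" if "C \<in> T" for C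
  proof (cases "C = A")
    case True
    then show ?thesis by (simp add: a_def)
  next
    case False
    have "\<not> C \<subseteq> A" using A that False assms(2) by (metis card_subset_eq card_mono le_antisym)
    then obtain i where "i \<in> C" "a i = 0" by (auto simp: a_def)
    then show ?thesis using False assms(2)[OF that] prod_zero[of C a] by auto
  qed
  have "poly_eval a (\<Sum>A\<in>T. \<Prod>i\<in>A. X i) = (\<Sum>C\<in>T. if C = A then 1 else 0)"
    unfolding poly_eval_sum poly_eval_prod poly_eval_X by (intro sum.cong refl *)
  also have "\<dots> = 1" using A(1) assms(1) by (subst sum.delta) auto
  finally show False using poly_eval_boolean_ideal[OF assms(3), of a] by simp
qed

lemma boolean_ideal_Int_polys_in:
  "boolean_ideal \<inter> polys_in N = {\<Sum>i<N. q i * (X i ^ 2 - X i) | q. \<forall>i<N. q i \<in> polys_in N}"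
proof -
  have "p \<in> small_ideal N" if p: "p \<in> boolean_ideal" "p \<in> polys_in N" for p
  proof -
    obtain T where T: "T \<subseteq> Pow {..<N}" "p - (\<Sum>A\<in>T. \<Prod>i\<in>A. X i) \<in> small_ideal N"
      using squarefree_form[OF p(2)] by blast
    have "p - (\<Sum>A\<in>T. \<Prod>i\<in>A. X i) \<in> boolean_ideal"
      using T(2) small_ideal_subset by blast
    then have "p - (p - (\<Sum>A\<in>T. \<Prod>i\<in>A. X i)) \<in> boolean_ideal"
      using p(1) unfolding boolean_ideal_def by (rule poly_ideal.span_diff[rotated])
    then have "(\<Sum>A\<in>T. \<Prod>i\<in>A. X i) \<in> boolean_ideal" by simp
    then have "T = {}" using T(1)
      by (intro squarefree_sum_in_ideal) (auto intro: finite_subset)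
    then show ?thesis using T(2) by simp
  qed
  then show ?thesis
    using small_ideal_subset[of N] small_ideal_subset_polys_in[of N] 
    unfolding small_ideal_def by blast
qed

quotient_type bpoly = f2poly / "\<lambda>p q. p - q \<in> boolean_ideal"
proof (rule equivpI)
  show "reflp (\<lambda>p q. p - q \<in> boolean_ideal)"
    by (simp add: reflp_def boolean_ideal_def poly_ideal.span_zero)
  show "symp (\<lambda>p q. p - q \<in> boolean_ideal)"
  proof (rule sympI)
    fix p q :: f2poly
    assume "p - q \<in> boolean_ideal"
    then have "- (p - q) \<in> boolean_ideal"
      unfolding boolean_ideal_def by (rule poly_ideal.span_neg)
    then show "q - p \<in> boolean_ideal" by simp
  qed
  show "transp (\<lambda>p q. p - q \<in> boolean_ideal)"
  proof (rule transpI)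
    fix p q r :: f2poly
    assume "p - q \<in> boolean_ideal" "q - r \<in> boolean_ideal"
    then have "(p - q) + (q - r) \<in> boolean_ideal"
      unfolding boolean_ideal_def by (rule poly_ideal.span_add)
    then show "p - r \<in> boolean_ideal" by simp
  qed
qed

lemma boolean_ideal_eq: "p = q \<Longrightarrow> p - q \<in> boolean_ideal"
  by (simp add: boolean_ideal_def poly_ideal.span_zero)

instantiation bpoly :: comm_ring_1
begin

lift_definition zero_bpoly :: bpoly is 0 .
lift_definition one_bpoly :: bpoly is 1 .

lift_definition plus_bpoly :: "bpoly \<Rightarrow> bpoly \<Rightarrow> bpoly" is "(+)"
proof -
  fix p p' q q' :: f2poly
  assume "p - p' \<in> boolean_ideal" "q - q' \<in> boolean_ideal"
  then have "(p - p') + (q - q') \<in> boolean_ideal"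
    unfolding boolean_ideal_def by (rule poly_ideal.span_add)
  then show "p + q - (p' + q') \<in> boolean_ideal" by (simp add: algebra_simps)
qed

lift_definition uminus_bpoly :: "bpoly \<Rightarrow> bpoly" is uminus
proof -
  fix p p' :: f2poly
  assume "p - p' \<in> boolean_ideal"
  then have "- (p - p') \<in> boolean_ideal"
    unfolding boolean_ideal_def by (rule poly_ideal.span_neg)
  then show "- p - - p' \<in> boolean_ideal" by simp
qed

lift_definition minus_bpoly :: "bpoly \<Rightarrow> bpoly \<Rightarrow> bpoly" is "(-)"
proof -
  fix p p' q q' :: f2poly
  assume "p - p' \<in> boolean_ideal" "q - q' \<in> boolean_ideal"
  then have "(p - p') - (q - q') \<in> boolean_ideal"
    unfolding boolean_ideal_def by (rule poly_ideal.span_diff)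
  then show "p - q - (p' - q') \<in> boolean_ideal" by (simp add: algebra_simps)
qed

lift_definition times_bpoly :: "bpoly \<Rightarrow> bpoly \<Rightarrow> bpoly" is "(*)"
proof -
  fix p p' q q' :: f2poly
  assume "p - p' \<in> boolean_ideal" "q - q' \<in> boolean_ideal"
  then have "q * (p - p') + p' * (q - q') \<in> boolean_ideal"
    unfolding boolean_ideal_def by (intro poly_ideal.span_add poly_ideal.span_scale)
  then show "p * q - p' * q' \<in> boolean_ideal" by (simp add: algebra_simps)
qed

instance
proof
  fix f g h :: bpoly
  show "f + g + h = f + (g + h)" by transfer (intro boolean_ideal_eq add.assoc)
  show "f + g = g + f" by transfer (intro boolean_ideal_eq add.commute)
  show "0 + f = f" by transfer (intro boolean_ideal_eq add_0_left)
  show "- f + f = 0" by transfer (intro boolean_ideal_eq ab_left_minus)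
  show "f - g = f + - g" by transfer (intro boolean_ideal_eq diff_conv_add_uminus)
  show "f * g * h = f * (g * h)" by transfer (intro boolean_ideal_eq mult.assoc)
  show "f * g = g * f" by transfer (intro boolean_ideal_eq mult.commute)
  show "1 * f = f" by transfer (intro boolean_ideal_eq mult_1_left)
  show "(f + g) * h = f * h + g * h" by transfer (intro boolean_ideal_eq distrib_right)
  show "(0::bpoly) \<noteq> 1"
  proof transfer
    show "(0::f2poly) - 1 \<notin> boolean_ideal"
      using poly_eval_boolean_ideal[of "0 - 1" undefined] by (auto simp: poly_eval_diff poly_eval_uminus)
  qed
qed

end

lift_definition bvar :: "nat \<Rightarrow> bpoly" is X .

lift_definition beval :: "(nat \<Rightarrow> bit) \<Rightarrow> bpoly \<Rightarrow> bit" is poly_eval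
proof -
  fix a :: "nat \<Rightarrow> bit" and p q :: f2poly
  assume "p - q \<in> boolean_ideal"
  then have "poly_eval a (p - q) = 0" by (rule poly_eval_boolean_ideal)
  then show "poly_eval a p = poly_eval a q"
    by (cases "poly_eval a p"; cases "poly_eval a q") (simp_all add: poly_eval_diff)
qed

definition B :: "nat \<Rightarrow> bpoly set" where
  "B N = abs_bpoly ` polys_in N"

lemma beval_zero [simp]: "beval a 0 = 0"
  by transfer simp

lemma beval_one [simp]: "beval a 1 = 1"
  by transfer simp

lemma beval_bvar [simp]: "beval a (bvar i) = a i"
  by transfer simp

lemma beval_add [simp]: "beval a (f + g) = beval a f + beval a g"
  by transfer (rule poly_eval_add)

lemma beval_mult [simp]: "beval a (f * g) = beval a f * beval a g"
  by transfer (rule poly_eval_mult)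

lemma abs_bpoly_add: "abs_bpoly (p + q) = abs_bpoly p + abs_bpoly q"
  by (simp add: plus_bpoly.abs_eq)

lemma abs_bpoly_mult: "abs_bpoly (p * q) = abs_bpoly p * abs_bpoly q"
  by (simp add: times_bpoly.abs_eq)

lemma abs_bpoly_sum: "abs_bpoly (sum f A) = (\<Sum>x\<in>A. abs_bpoly (f x))"
  by (induction A rule: infinite_finite_induct) (auto simp: abs_bpoly_add zero_bpoly_def)

lemma abs_bpoly_prod: "abs_bpoly (prod f A) = (\<Prod>x\<in>A. abs_bpoly (f x))"
  by (induction A rule: infinite_finite_induct) (auto simp: abs_bpoly_mult one_bpoly_def)

subsection \<open>Square-free terms, support and degree\<close>

text \<open>A square-free term is given by the finite set of indices of its indeterminates.\<close>

definition bterm :: "nat set \<Rightarrow> bpoly" where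
  "bterm A = (\<Prod>i\<in>A. bvar i)"

definition supp :: "bpoly \<Rightarrow> nat set set" where
  "supp f = (THE T. finite T \<and> (\<forall>A\<in>T. finite A) \<and> f = (\<Sum>A\<in>T. bterm A))"

lemma bterm_eq_abs: "bterm A = abs_bpoly (\<Prod>i\<in>A. X i)"
  by (simp add: bterm_def abs_bpoly_prod bvar_def)

lemma unique_squarefree_form:
  "\<exists>!T. finite T \<and> (\<forall>A\<in>T. finite A) \<and> f = (\<Sum>A\<in>T. bterm A)"
proof (rule ex_ex1I)
  obtain p where f: "f = abs_bpoly p" using Quotient3_abs_rep[OF Quotient3_bpoly] by metis
  obtain N where "p \<in> polys_in N" using polys_in_ex by blast
  then obtain T where T: "T \<subseteq> Pow {..<N}" "p - (\<Sum>A\<in>T. \<Prod>i\<in>A. X i) \<in> small_ideal N"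
    using squarefree_form by blast
  then have "abs_bpoly p = abs_bpoly (\<Sum>A\<in>T. \<Prod>i\<in>A. X i)"
    using small_ideal_subset bpoly.abs_eq_iff by blast
  then have "f = (\<Sum>A\<in>T. bterm A)"
    by (simp add: f bterm_eq_abs abs_bpoly_sum)
  moreover have "finite T" "\<forall>A\<in>T. finite A" using T(1) by (auto intro: finite_subset)
  ultimately show "\<exists>T. finite T \<and> (\<forall>A\<in>T. finite A) \<and> f = (\<Sum>A\<in>T. bterm A)" by blast
next
  fix S T :: "nat set set"
  let ?h = "\<lambda>A. \<Prod>i\<in>A. X i"
  assume S: "finite S \<and> (\<forall>A\<in>S. finite A) \<and> f = (\<Sum>A\<in>S. bterm A)"
    and T: "finite T \<and> (\<forall>A\<in>T. finite A) \<and> f = (\<Sum>A\<in>T. bterm A)"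
  then have "abs_bpoly (sum ?h S) = abs_bpoly (sum ?h T)"
    by (simp add: bterm_eq_abs abs_bpoly_sum)
  then have "sum ?h S - sum ?h T \<in> boolean_ideal" using bpoly.abs_eq_iff by blast
  then have "sum ?h ((S - T) \<union> (T - S)) \<in> boolean_ideal"
    using S T by (simp only: f2poly_minus_eq_plus squarefree_sum_add)
  then have "(S - T) \<union> (T - S) = {}"
    using S T by (intro squarefree_sum_in_ideal) auto
  then show "S = T" by blast
qed

text \<open>With this convention the zero polynomial has degree 0.\<close>

definition bdegree :: "bpoly \<Rightarrow> nat" where
  "bdegree f = Max (insert 0 (card ` supp f))"

definition nonlinear_terms :: "bpoly \<Rightarrow> nat set set" where
  "nonlinear_terms f = {A \<in> supp f. card A \<ge> 2}"

subsection \<open>Linear Boolean polynomials\<close>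

interpretation bpoly_space: vector_space "\<lambda>(c::bit) (f::bpoly). of_bit c * f"
proof
  fix a b :: bit and f g :: bpoly
  have two: "h + h = 0" for h :: bpoly
  by transfer (intro boolean_ideal_eq f2poly_double)
  show "of_bit a * (f + g) = of_bit a * f + of_bit a * g" by (rule distrib_left)
  show "of_bit (a + b) * f = of_bit a * f + of_bit b * f"
    by (cases a; cases b) (simp_all add: two)
  show "of_bit a * (of_bit b * f) = of_bit (a * b) * f"
    by (cases a; cases b) simp_all
  show "of_bit 1 * f = f" by simp
qed

definition L :: "nat \<Rightarrow> bpoly set" where
  "L N = module.span (\<lambda>(c::bit) (f::bpoly). of_bit c * f) (insert 1 (bvar ` {..<N}))"


section \<open>Zero sets and 2-XNF representations\<close>

definition points :: "nat \<Rightarrow> (nat \<Rightarrow> bit) set" where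
  "points N = {..<N} \<rightarrow>\<^sub>E UNIV"

definition zeros :: "nat \<Rightarrow> bpoly set \<Rightarrow> (nat \<Rightarrow> bit) set" where
  "zeros N S = {a \<in> points N. \<forall>f\<in>S. beval a f = 0}"

definition proj_equiv :: "nat \<Rightarrow> (nat \<Rightarrow> bit) set \<Rightarrow> (nat \<Rightarrow> bit) set \<Rightarrow> bool" where
  "proj_equiv n S T \<longleftrightarrow> bij_betw (\<lambda>a. restrict a {..<n}) T S"

definition is_2xnf_rep :: "nat \<Rightarrow> bpoly set \<Rightarrow> bpoly set \<Rightarrow> bool" where
  "is_2xnf_rep n S I \<longleftrightarrow>
    (\<exists>m k s f g l.
      f ` {..<k::nat} \<subseteq> L (n + m) \<and> g ` {..<k} \<subseteq> L (n + m) \<and> l ` {..<s::nat} \<subseteq> L (n + m) \<and>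
      S = (\<lambda>i. f i * g i) ` {..<k} \<union> l ` {..<s} \<and>
      proj_equiv n (zeros n I) (zeros (n + m) S))"

definition principal_ideal :: "nat \<Rightarrow> bpoly \<Rightarrow> bpoly set" where
  "principal_ideal n f = {h * f | h. h \<in> B n}"


section \<open>The procedure\<close>

text \<open>
  A state \<open>(i, f, M)\<close> holds the number \<open>i\<close> of indeterminates \<open>y_1, ..., y_i\<close> introduced so far.
  The relation contains one pass through the loop for every admissible choice of \<open>l\<^sub>1\<close>, \<open>l\<^sub>2\<close>
  and \<open>f'\<close>; the new indeterminate \<open>y_{i+1}\<close> is \<open>bvar (n + i)\<close>.
\<close>

type_synonym qanf_state = "nat \<times> bpoly \<times> bpoly set"

inductive qanf_step :: "nat \<Rightarrow> qanf_state \<Rightarrow> qanf_state \<Rightarrow> bool" for n where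
  "\<lbrakk>bdegree f = 2; l\<^sub>1 \<in> L n; l\<^sub>2 \<in> L n; l\<^sub>1 \<noteq> l\<^sub>2; f' \<in> B (n + i); f = l\<^sub>1 * l\<^sub>2 + f';
    card (nonlinear_terms f') < card (nonlinear_terms f); y = bvar (n + i)\<rbrakk>
   \<Longrightarrow> qanf_step n (i, f, M) (Suc i, y + f', M \<union> {y * (l\<^sub>2 + 1), l\<^sub>2 * (l\<^sub>1 + y)})"

end

theory Submission
  imports Defs
begin

text \<open>
  On the common zeros of \<open>y * (l\<^sub>2 + 1)\<close> and \<open>l\<^sub>2 * (l\<^sub>1 + y)\<close> the new indeterminate \<open>y\<close> is forced to
  take the value of \<open>l\<^sub>1 * l\<^sub>2\<close>. Every loop pass therefore extends each common zero of \<open>M\<close> in exactly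
  one way, and the current polynomial keeps the values of the input polynomial there. The procedure
  never gets stuck, because all non-linear terms stay products of two of the original
  indeterminates \<open>x_i\<close>, and such a term can be split off; it terminates because the number of
  non-linear terms decreases.
\<close>

section \<open>Supports\<close>

lemma bpoly_double: "h + h = 0" for h :: bpoly
  by transfer (intro boolean_ideal_eq f2poly_double)

lemma
  shows finite_supp [simp]: "finite (supp f)"
    and finite_supp_term: "A \<in> supp f \<Longrightarrow> finite A"
    and sum_supp: "(\<Sum>A\<in>supp f. bterm A) = f"
  using theI'[OF unique_squarefree_form[of f]] by (auto simp: supp_def[symmetric])

lemma supp_eqI:
  assumes "finite T" "\<And>A. A \<in> T \<Longrightarrow> finite A" "f = (\<Sum>A\<in>T. bterm A)"
  shows "supp f = T"
  unfolding supp_def using assms unique_squarefree_form[of f] by (intro the1_equality) auto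

lemma supp_zero [simp]: "supp 0 = {}"
  by (rule supp_eqI) auto

lemma supp_bterm [simp]: "finite A \<Longrightarrow> supp (bterm A) = {A}"
  by (rule supp_eqI) auto

lemma supp_bvar [simp]: "supp (bvar i) = {{i}}"
  using supp_bterm[of "{i}"] by (simp add: bterm_def)

lemma supp_one [simp]: "supp 1 = {{}}"
  using supp_bterm[of "{}"] by (simp add: bterm_def)

text \<open>A term common to both summands occurs twice and vanishes in characteristic 2, so
  supports add by symmetric difference.\<close>

lemma supp_add: "supp (f + g) = (supp f - supp g) \<union> (supp g - supp f)"
proof (rule supp_eqI)
  let ?S = "supp f" and ?T = "supp g"
  have "f = sum bterm (?S - ?T) + sum bterm (?S \<inter> ?T)"
    "g = sum bterm (?T - ?S) + sum bterm (?S \<inter> ?T)"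
    using sum.Int_Diff[of ?S bterm ?T] sum.Int_Diff[of ?T bterm ?S]
    by (simp_all add: sum_supp add.commute Int_commute)
  then have "f + g = sum bterm (?S - ?T) + sum bterm (?T - ?S)
      + (sum bterm (?S \<inter> ?T) + sum bterm (?S \<inter> ?T))"
    by (metis (no_types, lifting) add.assoc add.commute)
  also have "\<dots> = sum bterm ((?S - ?T) \<union> (?T - ?S))"
    by (subst sum.union_disjoint) (auto simp: bpoly_double)
  finally show "f + g = sum bterm ((?S - ?T) \<union> (?T - ?S))" .
qed (auto simp: finite_supp_term)

lemma supp_add_subset: "supp (f + g) \<subseteq> supp f \<union> supp g"
  by (auto simp: supp_add)

lemma supp_sum_subset: "supp (sum h A) \<subseteq> (\<Union>x\<in>A. supp (h x))"
proof (induction A rule: infinite_finite_induct)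
  case (insert x A)
  then show ?case using supp_add_subset[of "h x" "sum h A"] by auto
qed auto

section \<open>Products of square-free terms\<close>

lemma bvar_idem: "bvar i * bvar i = bvar i"
proof transfer
  fix i
  have "X i ^ 2 - X i \<in> boolean_ideal"
    unfolding boolean_ideal_def by (intro poly_ideal.span_base rangeI)
  then show "X i * X i - X i \<in> boolean_ideal" by (simp add: power2_eq_square)
qed

text \<open>Idempotence of the indeterminates absorbs every repeated factor, so index sets are
  united instead of exponents added.\<close>

lemma bterm_mult: "finite A \<Longrightarrow> finite C \<Longrightarrow> bterm A * bterm C = bterm (A \<union> C)"
proof (induction A rule: finite_induct)
  case empty
  then show ?case by (simp add: bterm_def)
next
  case (insert i A)
  have "bvar i * bterm (A \<union> C) = bterm (insert i (A \<union> C))"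
  proof (cases "i \<in> C")
    case True
    have "bterm (A \<union> C) = bvar i * bterm (A \<union> C - {i})"
      unfolding bterm_def using insert True by (intro prod.remove) auto
    then have "bvar i * bterm (A \<union> C) = bterm (A \<union> C)"
      by (simp add: bvar_idem flip: mult.assoc)
    with True show ?thesis by (simp add: insert_absorb)
  next
    case False
    with insert show ?thesis by (simp add: bterm_def)
  qed
  with insert show ?case by (simp add: bterm_def mult.assoc)
qed

text \<open>Both square-free forms are expanded and multiplied term by term. Only an inclusion
  results, as different pairs with the same union may cancel.\<close>

lemma supp_mult_subset: "supp (f * g) \<subseteq> (\<lambda>(A, C). A \<union> C) ` (supp f \<times> supp g)"
proof -
  have "f * g = (\<Sum>A\<in>supp f. \<Sum>C\<in>supp g. bterm A * bterm C)"
    by (metis sum_supp sum_product)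
  also have "\<dots> = (\<Sum>A\<in>supp f. \<Sum>C\<in>supp g. bterm (A \<union> C))"
    by (intro sum.cong refl bterm_mult) (auto simp: finite_supp_term)
  finally have "supp (f * g) = supp (\<Sum>A\<in>supp f. \<Sum>C\<in>supp g. bterm (A \<union> C))" by simp
  also have "\<dots> \<subseteq> (\<Union>A\<in>supp f. supp (\<Sum>C\<in>supp g. bterm (A \<union> C)))"
    by (rule supp_sum_subset)
  also have "\<dots> \<subseteq> (\<Union>A\<in>supp f. \<Union>C\<in>supp g. supp (bterm (A \<union> C)))"
    by (intro UN_mono subset_refl supp_sum_subset)
  also have "\<dots> \<subseteq> (\<lambda>(A, C). A \<union> C) ` (supp f \<times> supp g)"
    by (auto simp: finite_supp_term)
  finally show ?thesis .
qed

section \<open>Membership in \<open>B N\<close> and \<open>L N\<close> read off the support\<close>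

lemma B_iff_supp: "f \<in> B N \<longleftrightarrow> supp f \<subseteq> Pow {..<N}"
proof
  assume "f \<in> B N"
  then obtain p where p: "f = abs_bpoly p" "p \<in> polys_in N" by (auto simp: B_def)
  \<comment> \<open>The square-free form of a representative in the first \<open>N\<close>
    indeterminates stays within them, and by uniqueness it is the support.\<close>
  obtain T where T: "T \<subseteq> Pow {..<N}" "p - (\<Sum>A\<in>T. \<Prod>i\<in>A. X i) \<in> small_ideal N"
    using squarefree_form[OF p(2)] by blast
  then have "f = abs_bpoly (\<Sum>A\<in>T. \<Prod>i\<in>A. X i)"
    using small_ideal_subset bpoly.abs_eq_iff p by blast
  then have "f = (\<Sum>A\<in>T. bterm A)" by (simp add: bterm_eq_abs abs_bpoly_sum)
  then have "supp f = T" using T(1) by (intro supp_eqI) (auto intro: finite_subset)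
  with T show "supp f \<subseteq> Pow {..<N}" by simp
next
  assume *: "supp f \<subseteq> Pow {..<N}"
  have "f = abs_bpoly (\<Sum>A\<in>supp f. \<Prod>i\<in>A. X i)"
    by (simp add: abs_bpoly_sum sum_supp flip: bterm_eq_abs)
  moreover have "(\<Sum>A\<in>supp f. \<Prod>i\<in>A. X i) \<in> polys_in N"
    using * by (intro polys_in_sum polys_in_prod polys_in_X) auto
  ultimately show "f \<in> B N" unfolding B_def by blast
qed

lemma bdegree_le_iff: "bdegree f \<le> d \<longleftrightarrow> (\<forall>A\<in>supp f. card A \<le> d)"
  by (auto simp: bdegree_def)

text \<open>The generators of \<open>L N\<close> are exactly the square-free terms of degree at most
  1 in the first \<open>N\<close> indeterminates. One direction is induction over the span, the
  other writes \<open>f\<close> as the sum of its support.\<close>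

lemma L_iff: "f \<in> L N \<longleftrightarrow> f \<in> B N \<and> bdegree f \<le> 1"
proof
  assume "f \<in> L N"
  then show "f \<in> B N \<and> bdegree f \<le> 1" unfolding L_def
  proof (induction rule: bpoly_space.span_induct_alt)
    case base
    then show ?case by (simp add: B_iff_supp bdegree_le_iff)
  next
    case (step c x y)
    have "supp (of_bit c * x) \<subseteq> supp x" by (cases c) auto
    then have "supp (of_bit c * x + y) \<subseteq> supp x \<union> supp y" using supp_add_subset by blast
    moreover have "\<forall>A\<in>supp x. A \<subseteq> {..<N} \<and> card A \<le> 1" using step(1) by auto
    ultimately show ?case using step(2) unfolding B_iff_supp bdegree_le_iff by blast
  qed
next
  assume f: "f \<in> B N \<and> bdegree f \<le> 1"
  have "bterm A \<in> L N" if "A \<in> supp f" for A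
  proof -
    have A: "finite A" "A \<subseteq> {..<N}" "card A \<le> 1"
      using f that finite_supp_term unfolding B_iff_supp bdegree_le_iff by auto
    then consider "A = {}" | i where "A = {i}" "i < N"
      by (metis One_nat_def card_1_singletonE card_0_eq insert_subset le_Suc_eq le_zero_eq lessThan_iff)
    then have "bterm A \<in> insert 1 (bvar ` {..<N})" by cases (auto simp: bterm_def)
    then show ?thesis unfolding L_def by (rule bpoly_space.span_base)
  qed
  then have "(\<Sum>A\<in>supp f. bterm A) \<in> L N"
    unfolding L_def by (intro bpoly_space.span_sum)
  then show "f \<in> L N" by (simp only: sum_supp)
qed

lemma B_mono: "N \<le> N' \<Longrightarrow> B N \<subseteq> B N'"
  unfolding B_def by (intro image_mono polys_in_mono)

lemma L_mono: "N \<le> N' \<Longrightarrow> L N \<subseteq> L N'"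
  using B_mono[of N N'] by (auto simp: L_iff)

lemma bvar_in_B: "i < N \<Longrightarrow> bvar i \<in> B N"
  by (simp add: B_iff_supp)

lemma bvar_in_L: "i < N \<Longrightarrow> bvar i \<in> L N"
  by (simp add: L_iff B_iff_supp bdegree_le_iff)

lemma one_in_B: "1 \<in> B N"
  by (simp add: B_iff_supp)

lemma one_in_L: "1 \<in> L N"
  by (simp add: L_iff one_in_B bdegree_le_iff)

lemma B_add: "f \<in> B N \<Longrightarrow> g \<in> B N \<Longrightarrow> f + g \<in> B N"
  using supp_add_subset[of f g] by (auto simp: B_iff_supp)

lemma L_add: "f \<in> L N \<Longrightarrow> g \<in> L N \<Longrightarrow> f + g \<in> L N"
  unfolding L_def by (rule bpoly_space.span_add)

text \<open>Each such term is a union of two sets with at most one element. For factors from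
  \<open>L n\<close> this keeps the new indeterminates out of the non-linear terms.\<close>

lemma supp_L_mult:
  assumes "l\<^sub>1 \<in> L N" "l\<^sub>2 \<in> L N" "A \<in> supp (l\<^sub>1 * l\<^sub>2)"
  shows "A \<subseteq> {..<N}" "card A \<le> 2"
proof -
  obtain C D where CD: "C \<in> supp l\<^sub>1" "D \<in> supp l\<^sub>2" "A = C \<union> D"
    using supp_mult_subset[of l\<^sub>1 l\<^sub>2] assms(3) by auto
  have C: "C \<subseteq> {..<N}" "card C \<le> 1" and D: "D \<subseteq> {..<N}" "card D \<le> 1"
    using assms(1,2) CD(1,2) by (auto simp: L_iff B_iff_supp bdegree_le_iff)
  show "A \<subseteq> {..<N}" using C D CD by simp
  show "card A \<le> 2" unfolding CD(3) using C D card_Un_le[of C D] by linarith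
qed

section \<open>Evaluation\<close>

text \<open>Evaluating the square-free form of \<open>f\<close> reads only coordinates below
  \<open>N\<close>.\<close>

lemma beval_cong:
  assumes "f \<in> B N" "\<And>i. i < N \<Longrightarrow> a i = b i"
  shows "beval a f = beval b f"
proof -
  have sums: "beval c (\<Sum>A\<in>T. bterm A) = (\<Sum>A\<in>T. \<Prod>i\<in>A. c i)" for c T
  proof -
    have "beval c (bterm A) = (\<Prod>i\<in>A. c i)" for A
      unfolding bterm_def by (induction A rule: infinite_finite_induct) auto
    then show ?thesis by (induction T rule: infinite_finite_induct) auto
  qed
  have "(\<Sum>A\<in>supp f. \<Prod>i\<in>A. a i) = (\<Sum>A\<in>supp f. \<Prod>i\<in>A. b i)"
    using assms by (intro sum.cong prod.cong) (auto simp: B_iff_supp)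
  then show ?thesis using sums[of a "supp f"] sums[of b "supp f"] by (simp add: sum_supp)
qed

lemma beval_restrict: "f \<in> B N \<Longrightarrow> beval (restrict a {..<N}) f = beval a f"
  by (rule beval_cong) auto

lemma zeros_principal_ideal: "f \<in> B n \<Longrightarrow> zeros n (principal_ideal n f) = zeros n {f}"
  unfolding zeros_def principal_ideal_def using one_in_B[of n] by force

section \<open>The procedure\<close>

text \<open>The bound on \<open>nonlinear_terms g\<close> ensures progress, since the factors to
  split off must lie in \<open>L n\<close>. The bijection goes onto all of \<open>points n\<close>
  because the gates in \<open>M\<close> leave the original coordinates free; the condition
  \<open>f = 0\<close> is carried by \<open>g\<close> alone. Finiteness and the product form of
  \<open>M\<close> serve the final representation.\<close>

definition qanf_invar :: "nat \<Rightarrow> bpoly \<Rightarrow> qanf_state \<Rightarrow> bool" where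
  "qanf_invar n f = (\<lambda>(i, g, M).
     g \<in> B (n + i) \<and> bdegree g \<le> 2 \<and> nonlinear_terms g \<subseteq> Pow {..<n} \<and>
     finite M \<and> M \<subseteq> {u * v | u v. u \<in> L (n + i) \<and> v \<in> L (n + i)} \<and>
     bij_betw (\<lambda>a. restrict a {..<n}) (zeros (n + i) M) (points n) \<and>
     (\<forall>a\<in>zeros (n + i) M. beval a g = beval a f))"

lemma qanf_invar_init:
  assumes "f \<in> B n" "bdegree f \<le> 2"
  shows "qanf_invar n f (0, f, {})"
proof -
  \<comment> \<open>Without gates the projection is the identity on \<open>points n\<close>.\<close>
  have "bij_betw (\<lambda>a. restrict a {..<n}) (points n) (points n)"
    by (rule bij_betw_byWitness[where f' = "\<lambda>a. a"]) (auto simp: points_def PiE_restrict)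
  then show ?thesis
    using assms by (auto simp: qanf_invar_def zeros_def nonlinear_terms_def B_iff_supp)
qed

text \<open>The support changes only at the singleton \<open>{N}\<close>, which is a linear
  term.\<close>

lemma nonlinear_terms_add_bvar:
  assumes "f' \<in> B N"
  shows "nonlinear_terms (bvar N + f') = nonlinear_terms f'"
  by (auto simp: nonlinear_terms_def supp_add)

text \<open>For \<open>c = 0\<close> the first equation forces \<open>y = 0\<close>; for
  \<open>c = 1\<close> the second forces \<open>y = b\<close>.\<close>

lemma bit_gate: "y * (c + 1) = 0 \<and> c * (b + y) = 0 \<longleftrightarrow> y = b * c" for b c y :: bit
  by (cases b; cases c; cases y) simp_all

text \<open>The two new polynomials determine coordinate \<open>N\<close> from the earlier ones.
  Setting it to the forced value inverts the projection, and \<open>M\<close>,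
  \<open>l\<^sub>1\<close> and \<open>l\<^sub>2\<close> do not see the change.\<close>

lemma bij_betw_zeros_gate:
  assumes l: "l\<^sub>1 \<in> B N" "l\<^sub>2 \<in> B N" and M: "M \<subseteq> B N"
  defines "M' \<equiv> M \<union> {bvar N * (l\<^sub>2 + 1), l\<^sub>2 * (l\<^sub>1 + bvar N)}"
  shows "bij_betw (\<lambda>a. restrict a {..<N}) (zeros (Suc N) M') (zeros N M)"
proof (rule bij_betw_byWitness[where f' = "\<lambda>a. a(N := beval a l\<^sub>1 * beval a l\<^sub>2)"])
  have gate: "a \<in> zeros (Suc N) M' \<longleftrightarrow>
      a \<in> points (Suc N) \<and> (\<forall>h\<in>M. beval a h = 0) \<and> a N = beval a l\<^sub>1 * beval a l\<^sub>2" for a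
    using bit_gate[of "a N" "beval a l\<^sub>2" "beval a l\<^sub>1"] by (auto simp: zeros_def M'_def)
  have upd: "beval (a(N := c)) h = beval a h" if "h \<in> B N" for a c h
    using that by (rule beval_cong) auto
  show "\<forall>a\<in>zeros (Suc N) M'. (restrict a {..<N})
      (N := beval (restrict a {..<N}) l\<^sub>1 * beval (restrict a {..<N}) l\<^sub>2) = a"
  proof
    fix a assume a: "a \<in> zeros (Suc N) M'"
    \<comment> \<open>Points are extensional: restriction makes coordinate \<open>N\<close>
      \<open>undefined\<close>, and restoring \<open>a N\<close> there recovers
      \<open>a\<close>.\<close>
    then have "(restrict a {..<N})(N := a N) = a"
      by (auto simp: gate points_def fun_eq_iff PiE_iff extensional_def less_Suc_eq)
    with a l show "(restrict a {..<N})
      (N := beval (restrict a {..<N}) l\<^sub>1 * beval (restrict a {..<N}) l\<^sub>2) = a"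
      by (simp add: gate beval_restrict)
  qed
  show "\<forall>a\<in>zeros N M. restrict (a(N := beval a l\<^sub>1 * beval a l\<^sub>2)) {..<N} = a"
    by (auto simp: zeros_def[of N M] points_def fun_eq_iff PiE_iff extensional_def)
  show "(\<lambda>a. restrict a {..<N}) ` zeros (Suc N) M' \<subseteq> zeros N M"
    using M by (auto simp: gate zeros_def[of N M] beval_restrict subset_iff) (simp add: points_def)
  show "(\<lambda>a. a(N := beval a l\<^sub>1 * beval a l\<^sub>2)) ` zeros N M \<subseteq> zeros (Suc N) M'"
    using M l by (auto simp: gate zeros_def[of N M] upd subset_iff)
      (auto simp: points_def PiE_iff extensional_def)
qed

lemma qanf_invar_step:
  assumes "qanf_step n s s'" "qanf_invar n f s" "f \<in> B n"
  shows "qanf_invar n f s'"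
  using assms(1,2)
proof cases
  case (1 g l\<^sub>1 l\<^sub>2 f' i y M)
  let ?N = "n + i"
  let ?M' = "M \<union> {bvar ?N * (l\<^sub>2 + 1), l\<^sub>2 * (l\<^sub>1 + bvar ?N)}"
  have inv: "g \<in> B ?N" "bdegree g \<le> 2" "nonlinear_terms g \<subseteq> Pow {..<n}" "finite M"
      "M \<subseteq> {u * v | u v. u \<in> L ?N \<and> v \<in> L ?N}"
      "bij_betw (\<lambda>a. restrict a {..<n}) (zeros ?N M) (points n)"
      "\<And>a. a \<in> zeros ?N M \<Longrightarrow> beval a g = beval a f"
    using assms(2) unfolding 1(1) qanf_invar_def by auto
  \<comment> \<open>In characteristic 2 the product is moved across by adding it. Hence any term of
    \<open>f'\<close> not in \<open>g\<close> comes from the product and uses original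
    indeterminates only.\<close>
  have f': "f' = g + l\<^sub>1 * l\<^sub>2"
    using 1 bpoly_double[of "l\<^sub>1 * l\<^sub>2"] by (simp add: add.commute add.left_commute)
  have supp_f': "A \<in> supp g \<or> A \<subseteq> {..<n} \<and> card A \<le> 2" if "A \<in> supp f'" for A
    using that supp_add_subset[of g "l\<^sub>1 * l\<^sub>2"] supp_L_mult[OF 1(4,5)] f' by auto
  have B: "bvar ?N + f' \<in> B (Suc ?N)"
    using 1 B_mono[of ?N "Suc ?N"] by (intro B_add bvar_in_B) auto
  have deg: "bdegree (bvar ?N + f') \<le> 2"
    using supp_f' inv(2) by (auto simp: bdegree_le_iff supp_add)
  have nonlin: "nonlinear_terms (bvar ?N + f') \<subseteq> Pow {..<n}"
    unfolding nonlinear_terms_add_bvar[OF 1(7)] using supp_f' inv(3) by (auto simp: nonlinear_terms_def)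
  have lL: "l\<^sub>1 \<in> L (Suc ?N)" "l\<^sub>2 \<in> L (Suc ?N)" using 1 L_mono[of n "Suc ?N"] by auto
  have new: "{bvar ?N * (l\<^sub>2 + 1), l\<^sub>2 * (l\<^sub>1 + bvar ?N)}
      \<subseteq> {u * v | u v. u \<in> L (Suc ?N) \<and> v \<in> L (Suc ?N)}"
  proof -
    have "bvar ?N \<in> L (Suc ?N)" "l\<^sub>2 + 1 \<in> L (Suc ?N)" "l\<^sub>1 + bvar ?N \<in> L (Suc ?N)"
      using lL by (auto intro: L_add bvar_in_L one_in_L)
    with lL show ?thesis by blast
  qed
  have prods: "?M' \<subseteq> {u * v | u v. u \<in> L (Suc ?N) \<and> v \<in> L (Suc ?N)}"
    using inv(5) new L_mono[of ?N "Suc ?N"] by fastforce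
  have lB: "l\<^sub>1 \<in> B ?N" "l\<^sub>2 \<in> B ?N" using 1 B_mono[of n ?N] by (auto simp: L_iff)
  have MB: "M \<subseteq> B ?N"
  proof
    fix h assume "h \<in> M"
    then obtain u v where "h = u * v" "u \<in> L ?N" "v \<in> L ?N" using inv(5) by blast
    then show "h \<in> B ?N" using supp_L_mult(1)[of u ?N v] by (auto simp: B_iff_supp)
  qed
  have bij: "bij_betw (\<lambda>a. restrict a {..<?N}) (zeros (Suc ?N) ?M') (zeros ?N M)"
    by (rule bij_betw_zeros_gate[OF lB MB])
  \<comment> \<open>Dropping the newest coordinate and then the older \<open>y_j\<close> is the
    projection to the first \<open>n\<close> coordinates.\<close>
  have "bij_betw (\<lambda>a. restrict a {..<n}) (zeros (Suc ?N) ?M') (points n)"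
    using bij_betw_trans[OF bij inv(6)]
    by (simp add: comp_def restrict_restrict Int_absorb1)
  moreover have "beval a (bvar ?N + f') = beval a f" if a: "a \<in> zeros (Suc ?N) ?M'" for a
  proof -
    have "a ?N = beval a l\<^sub>1 * beval a l\<^sub>2"
      using a bit_gate[of "a ?N" "beval a l\<^sub>2" "beval a l\<^sub>1"] by (auto simp: zeros_def)
    \<comment> \<open>The new coordinate has the value of the product that it replaces.\<close>
    then have "beval a (bvar ?N + f') = beval a g" using 1 by simp
    \<comment> \<open>The invariant compares \<open>g\<close> with \<open>f\<close> only on zeros of
      the old \<open>M\<close>, so the comparison is made at the projection of
      \<open>a\<close>.\<close>
    also have "\<dots> = beval (restrict a {..<?N}) g" using inv(1) by (simp add: beval_restrict)
    also have "\<dots> = beval (restrict a {..<?N}) f"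
      using bij a by (intro inv(7)) (auto simp: bij_betw_def)
    also have "\<dots> = beval a f" using assms(3) B_mono[of n ?N] by (intro beval_restrict) auto
    finally show ?thesis .
  qed
  ultimately show ?thesis
    using B deg nonlin inv(4) prods unfolding 1(2) 1(10) qanf_invar_def by simp
qed

section \<open>Termination, progress and correctness\<close>

lemma qanf_step_nonlinear_terms:
  "qanf_step n s s' \<Longrightarrow> card (nonlinear_terms (fst (snd s'))) < card (nonlinear_terms (fst (snd s)))"
  by (induction rule: qanf_step.induct) (simp add: nonlinear_terms_add_bvar)

text \<open>Degree 2 yields a term with exactly two indeterminates. By the invariant both are
  original, so they are admissible as \<open>l\<^sub>1\<close> and \<open>l\<^sub>2\<close>.\<close>

lemma qanf_progress:
  assumes "qanf_invar n f (i, g, M)" "bdegree g = 2"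
  shows "\<exists>s. qanf_step n (i, g, M) s"
proof -
  have inv: "g \<in> B (n + i)" "nonlinear_terms g \<subseteq> Pow {..<n}"
    using assms(1) by (auto simp: qanf_invar_def)
  have "\<not> bdegree g \<le> 1" using assms(2) by simp
  then obtain A where A: "A \<in> supp g" "\<not> card A \<le> 1" unfolding bdegree_le_iff by blast
  moreover have "card A \<le> 2" using A(1) assms(2) bdegree_le_iff[of g 2] by simp
  ultimately have "card A = 2" by simp
  then obtain p q where pq: "A = {p, q}" "p \<noteq> q" by (auto simp: card_2_iff)
  have An: "A \<subseteq> {..<n}" using A inv(2) by (auto simp: nonlinear_terms_def)
  have bt: "bvar p * bvar q = bterm A" using pq by (simp add: bterm_def)
  \<comment> \<open>Adding a term already present in \<open>g\<close> deletes it.\<close>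
  let ?f' = "g + bvar p * bvar q"
  have supp: "supp ?f' = supp g - {A}" using A(1) pq bt by (auto simp: supp_add)
  have "nonlinear_terms ?f' = nonlinear_terms g - {A}"
    using supp by (auto simp: nonlinear_terms_def)
  moreover have "A \<in> nonlinear_terms g" "finite (nonlinear_terms g)"
    using A by (auto simp: nonlinear_terms_def)
  ultimately have card: "card (nonlinear_terms ?f') < card (nonlinear_terms g)"
    by (metis card_Diff1_less)
  have "bvar p \<noteq> bvar q" using pq(2) supp_bvar by (metis singleton_inject)
  moreover have "g = bvar p * bvar q + ?f'"
    using bpoly_double[of "bvar p * bvar q"] by (simp add: add.left_commute)
  moreover have "?f' \<in> B (n + i)" using inv(1) supp by (auto simp: B_iff_supp)
  moreover have "bvar p \<in> L n" "bvar q \<in> L n" using An pq by (auto intro: bvar_in_L)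
  ultimately show ?thesis using assms(2) card by (blast intro: qanf_step.intros)
qed

text \<open>On leaving the loop \<open>g\<close> is linear, and it vanishes at a zero of
  \<open>M\<close> exactly when \<open>f\<close> vanishes at the projection. The bijection onto
  \<open>points n\<close> thus restricts to one onto the zeros of \<open>f\<close>.\<close>

lemma qanf_correct:
  assumes "qanf_invar n f (i, g, M)" "bdegree g \<noteq> 2" "f \<in> B n"
  shows "is_2xnf_rep n (M \<union> {g}) (principal_ideal n f)"
proof -
  let ?N = "n + i"
  have inv: "g \<in> B ?N" "bdegree g \<le> 2" "finite M"
      "M \<subseteq> {u * v | u v. u \<in> L ?N \<and> v \<in> L ?N}"
      "bij_betw (\<lambda>a. restrict a {..<n}) (zeros ?N M) (points n)"
      "\<And>a. a \<in> zeros ?N M \<Longrightarrow> beval a g = beval a f"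
    using assms(1) unfolding qanf_invar_def by auto
  have g: "g \<in> L ?N" using inv(1,2) assms(2) by (simp add: L_iff)
  \<comment> \<open>\<open>is_2xnf_rep\<close> asks for indexed factors, so \<open>M\<close> is
    enumerated and a factorization is chosen for each index.\<close>
  obtain h where h: "h ` {..<card M} = M"
    using ex_bij_betw_nat_finite[OF inv(3)] by (auto simp: bij_betw_def atLeast0LessThan)
  then have "\<forall>j\<in>{..<card M}. \<exists>u v. h j = u * v \<and> u \<in> L ?N \<and> v \<in> L ?N"
    using inv(4) by blast
  then obtain u v where uv: "\<forall>j\<in>{..<card M}. h j = u j * v j \<and> u j \<in> L ?N \<and> v j \<in> L ?N"
    by metis
  then have "(\<lambda>j. u j * v j) ` {..<card M} = h ` {..<card M}"
    by (intro image_cong) auto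
  then have "(\<lambda>j. u j * v j) ` {..<card M} = M" using h by simp
  moreover have "bij_betw (\<lambda>a. restrict a {..<n}) (zeros ?N (M \<union> {g})) (zeros n {f})"
  proof (rule bij_betw_subset[OF inv(5)])
    \<comment> \<open>As \<open>f\<close> depends only on the first \<open>n\<close> coordinates,
      the condition on \<open>g\<close> becomes one on the projected point.\<close>
    have *: "zeros ?N (M \<union> {g}) = {a \<in> zeros ?N M. beval (restrict a {..<n}) f = 0}"
      using inv(6) assms(3) by (auto simp: zeros_def beval_restrict)
    have "zeros n {f} = {a \<in> (\<lambda>a. restrict a {..<n}) ` zeros ?N M. beval a f = 0}"
      unfolding bij_betw_imp_surj_on[OF inv(5)] by (auto simp: zeros_def)
    then show "(\<lambda>a. restrict a {..<n}) ` zeros ?N (M \<union> {g}) = zeros n {f}"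
      unfolding * by auto
  qed (auto simp: zeros_def)
  \<comment> \<open>The products are the elements of \<open>M\<close>; \<open>g\<close> is the only
    linear entry, whence \<open>s = 1\<close> and a constant family.\<close>
  ultimately show ?thesis
    unfolding is_2xnf_rep_def proj_equiv_def zeros_principal_ideal[OF assms(3)] using uv g
    by (intro exI[of _ i] exI[of _ "card M"] exI[of _ 1] exI[of _ u] exI[of _ v] exI[of _ "\<lambda>_. g"])
      auto
qed

text \<open>With free choices in each pass, a run could continue forever, get stuck inside the loop,
  or return a wrong set. The three clauses rule these out in turn.\<close>

theorem proposition3p17:
  fixes n :: nat and f :: bpoly
  assumes "f \<in> B n" and "bdegree f \<le> 2"
  shows "(\<nexists>\<sigma> :: nat \<Rightarrow> qanf_state.
            \<sigma> 0 = (0, f, {}) \<and> (\<forall>k. qanf_step n (\<sigma> k) (\<sigma> (Suc k)))) \<and>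
         (\<forall>i g M. (qanf_step n)\<^sup>*\<^sup>* (0, f, {}) (i, g, M) \<longrightarrow>
            (bdegree g = 2 \<longrightarrow> (\<exists>s. qanf_step n (i, g, M) s)) \<and>
            (bdegree g \<noteq> 2 \<longrightarrow> is_2xnf_rep n (M \<union> {g}) (principal_ideal n f)))"
proof (intro conjI allI impI)
  show "\<nexists>\<sigma> :: nat \<Rightarrow> qanf_state.
      \<sigma> 0 = (0, f, {}) \<and> (\<forall>k. qanf_step n (\<sigma> k) (\<sigma> (Suc k)))"
  proof
    assume "\<exists>\<sigma> :: nat \<Rightarrow> qanf_state.
        \<sigma> 0 = (0, f, {}) \<and> (\<forall>k. qanf_step n (\<sigma> k) (\<sigma> (Suc k)))"
    then obtain \<sigma> where "\<And>k. qanf_step n (\<sigma> k) (\<sigma> (Suc k))" by blast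
    then have "\<forall>k. (\<sigma> (Suc k), \<sigma> k) \<in> measure (\<lambda>s. card (nonlinear_terms (fst (snd s))))"
      by (simp add: qanf_step_nonlinear_terms[of n])
    then show False using wf_measure wf_iff_no_infinite_down_chain by metis
  qed
next
  fix i g M
  assume reach: "(qanf_step n)\<^sup>*\<^sup>* (0, f, {}) (i, g, M)"
  have inv: "qanf_invar n f (i, g, M)"
    using reach
  proof (induction rule: rtranclp_induct)
    case base
    then show ?case using assms by (rule qanf_invar_init)
  next
    case (step s s')
    then show ?case using assms(1) qanf_invar_step by blast
  qed
  show "\<exists>s. qanf_step n (i, g, M) s" if "bdegree g = 2"
    using inv that by (rule qanf_progress)
  show "is_2xnf_rep n (M \<union> {g}) (principal_ideal n f)" if "bdegree g \<noteq> 2"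
    using inv that assms(1) by (rule qanf_correct)
qed

end
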